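(* Let $c>0$ be a sufficiently large fixed constant. For any $\epsilon>0$ satisfying $$\log N^{\mathrm{loc}}(\epsilon,c)>4\big(C(M)\epsilon^2\vee\log2\big),$$ the minimax risk over $K$ satisfies $$\mathcal R_n(f,K)\ge\frac{\epsilon^2}{8c^2}.$$
   Context: Fix an exponential family of densities $f(y;\theta)=h(y)\exp\{\theta T(y)-A(\theta)\}$ with natural parameter domain $\mathcal D=\{\theta\in\mathbb R:\int h(y)e^{\theta T(y)}dy<\infty\}$. Assume $\mathcal D$ is open, $A$ is twice continuously differentiable, $\operatorname{Var}_\theta(T(Y))>0$ for all $\theta\in\mathcal D$. Let $M>0$ be known with $[-2M,2M]\subset\mathcal D$, and let $K\subset[-M,M]^n$ be star-shaped (there is $x_0\in K$ such that the segment from $x_0$ to any $x\in K$ lies in $K$). One observes independent $Y_i\sim f(\cdot;\theta_{0,i})$, $i=1,\dots,n$, with unknown $\theta_0\in K$. The minimax risk is $\mathcal R_n(f,K)=\inf_{\hat\theta}\sup_{\theta_0\in K}\mathbb E\|\hat\theta(Y)-\theta_0\|_2^2$ over all measurable $\hat\theta$. $C(M)=\max_{|\theta|\le M}A''(\theta)$. $N(\delta,S)$ is the minimal cardinality of a Euclidean $\delta$-covering of $S$ by points of $S$; $B_2(\theta,\epsilon)$ is the closed Euclidean ball; $N^{\mathrm{loc}}(\epsilon,c)=\sup_{\theta\in K}N(\epsilon/c,B_2(\theta,\epsilon)\cap K)$. $a\vee b=\max(a,b)$. *)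

theory Defs
  imports "HOL-Probability.Probability" "HOL-Library.Extended_Nat"
begin

text \<open>Points of \<open>\<real>\<^sup>n\<close> are the extensional functions \<open>{..<n} \<rightarrow>\<^sub>E UNIV\<close> (so coordinates are numbered
  from 0), which is the space of the product measure indexed by \<open>{..<n}\<close>. A type-indexed vector space would not
  allow \<open>n\<close> to be quantified after the constant \<open>c\<close>.\<close>

definition euclid_dist :: "nat \<Rightarrow> (nat \<Rightarrow> real) \<Rightarrow> (nat \<Rightarrow> real) \<Rightarrow> real" where
  "euclid_dist n x y = L2_set (\<lambda>i. x i - y i) {..<n}"

definition euclid_cball :: "nat \<Rightarrow> (nat \<Rightarrow> real) \<Rightarrow> real \<Rightarrow> (nat \<Rightarrow> real) set" where
  "euclid_cball n x r = {y \<in> {..<n} \<rightarrow>\<^sub>E UNIV. euclid_dist n x y \<le> r}"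

definition star_shaped :: "nat \<Rightarrow> (nat \<Rightarrow> real) set \<Rightarrow> bool" where
  "star_shaped n K \<longleftrightarrow>
     (\<exists>x0\<in>K. \<forall>x\<in>K. \<forall>t\<in>{0..1}. (\<lambda>i\<in>{..<n}. (1 - t) * x0 i + t * x i) \<in> K)"

definition natural_domain :: "(real \<Rightarrow> real) \<Rightarrow> (real \<Rightarrow> real) \<Rightarrow> real set" where
  "natural_domain h T = {\<theta>. (\<integral>\<^sup>+y. ennreal (h y * exp (\<theta> * T y)) \<partial>lborel) < \<infinity>}"

definition exp_density ::
  "(real \<Rightarrow> real) \<Rightarrow> (real \<Rightarrow> real) \<Rightarrow> (real \<Rightarrow> real) \<Rightarrow> real \<Rightarrow> real \<Rightarrow> real" where
  "exp_density h T A \<theta> y = h y * exp (\<theta> * T y - A \<theta>)"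

definition exp_law ::
  "(real \<Rightarrow> real) \<Rightarrow> (real \<Rightarrow> real) \<Rightarrow> (real \<Rightarrow> real) \<Rightarrow> real \<Rightarrow> real measure" where
  "exp_law h T A \<theta> = density lborel (\<lambda>y. ennreal (exp_density h T A \<theta> y))"

text \<open>The condition \<open>prob_space\<close> says that each \<open>exp_density h T A \<theta>\<close> integrates to 1, which
  determines \<open>A\<close> on the natural domain; values of \<open>A\<close> elsewhere are irrelevant.\<close>

definition regular_exp_family ::
  "(real \<Rightarrow> real) \<Rightarrow> (real \<Rightarrow> real) \<Rightarrow> (real \<Rightarrow> real) \<Rightarrow> bool" where
  "regular_exp_family h T A \<longleftrightarrow>
     h \<in> borel_measurable borel \<and> (\<forall>y. 0 \<le> h y) \<and> T \<in> borel_measurable borel \<and>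
     (\<forall>\<theta>\<in>natural_domain h T. prob_space (exp_law h T A \<theta>)) \<and>
     open (natural_domain h T) \<and>
     (\<forall>\<theta>\<in>natural_domain h T. A differentiable (at \<theta>)) \<and>
     (\<forall>\<theta>\<in>natural_domain h T. deriv A differentiable (at \<theta>)) \<and>
     continuous_on (natural_domain h T) (deriv (deriv A)) \<and>
     (\<forall>\<theta>\<in>natural_domain h T. prob_space.variance (exp_law h T A \<theta>) T > 0)"

text \<open>The supremum is a maximum whenever \<open>A\<close> is \<open>C\<^sup>2\<close> near \<open>[-M, M]\<close> and \<open>M \<ge> 0\<close>.\<close>

definition max_curvature :: "(real \<Rightarrow> real) \<Rightarrow> real \<Rightarrow> real" where
  "max_curvature A M = (SUP \<theta>\<in>{-M..M}. deriv (deriv A) \<theta>)"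

definition is_covering ::
  "nat \<Rightarrow> real \<Rightarrow> (nat \<Rightarrow> real) set \<Rightarrow> (nat \<Rightarrow> real) set \<Rightarrow> bool" where
  "is_covering n \<delta> S C \<longleftrightarrow> C \<subseteq> S \<and> (\<forall>x\<in>S. \<exists>y\<in>C. euclid_dist n x y \<le> \<delta>)"

definition covering_number :: "nat \<Rightarrow> real \<Rightarrow> (nat \<Rightarrow> real) set \<Rightarrow> enat" where
  "covering_number n \<delta> S = (INF C\<in>{C. finite C \<and> is_covering n \<delta> S C}. enat (card C))"

definition local_covering_number ::
  "nat \<Rightarrow> (nat \<Rightarrow> real) set \<Rightarrow> real \<Rightarrow> real \<Rightarrow> enat" where
  "local_covering_number n K \<epsilon> c =
     (SUP \<theta>\<in>K. covering_number n (\<epsilon> / c) (euclid_cball n \<theta> \<epsilon> \<inter> K))"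

definition log_enat :: "enat \<Rightarrow> ereal" where
  "log_enat N = (case N of enat k \<Rightarrow> ereal (ln (real k)) | \<infinity> \<Rightarrow> \<infinity>)"

text \<open>The observation \<open>Y = (Y\<^sub>i)\<close> enters only through its law, a product measure by independence.
  Since risks may be infinite, they are taken in \<open>ennreal\<close>.\<close>

definition risk ::
  "nat \<Rightarrow> (real \<Rightarrow> real) \<Rightarrow> (real \<Rightarrow> real) \<Rightarrow> (real \<Rightarrow> real) \<Rightarrow>
   ((nat \<Rightarrow> real) \<Rightarrow> (nat \<Rightarrow> real)) \<Rightarrow> (nat \<Rightarrow> real) \<Rightarrow> ennreal" where
  "risk n h T A est \<theta>0 =
     (\<integral>\<^sup>+y. ennreal ((euclid_dist n (est y) \<theta>0)\<^sup>2) \<partial>(\<Pi>\<^sub>M i\<in>{..<n}. exp_law h T A (\<theta>0 i)))"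

definition minimax_risk ::
  "nat \<Rightarrow> (real \<Rightarrow> real) \<Rightarrow> (real \<Rightarrow> real) \<Rightarrow> (real \<Rightarrow> real) \<Rightarrow> (nat \<Rightarrow> real) set \<Rightarrow> ennreal" where
  "minimax_risk n h T A K =
     (INF est \<in> (\<Pi>\<^sub>M i\<in>{..<n}. borel) \<rightarrow>\<^sub>M (\<Pi>\<^sub>M i\<in>{..<n}. borel).
        SUP \<theta>0\<in>K. risk n h T A est \<theta>0)"

end

theory Submission
  imports Defs
begin

text \<open>
The lower bound is a testing argument. A large local covering number provides a centre \<open>\<psi> \<in> K\<close> and
\<open>m\<close> points of \<open>K\<close> within distance \<open>\<epsilon>\<close> of \<open>\<psi>\<close>, at mutual distances greater than \<open>\<delta> = \<epsilon> / c\<close>, with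
\<open>ln m > 4\<kappa>\<close> for \<open>\<kappa> = max (C(M) * \<epsilon>\<^sup>2) (ln 2)\<close> (\<open>exists_packing_of_local_covering_number\<close>). For a given
estimator, the events \<open>B \<theta>\<close> that it lands within \<open>\<delta> / 2\<close> of a packing point \<open>\<theta>\<close> are disjoint, so under
the law of the centre one of them has probability at most \<open>1 / m\<close>
(\<open>exists_prob_le_inverse_card\<close>). Passing from the law of the centre to the law of that \<open>\<theta>\<close> can raise the
probability of this rare event only at the cost of relative entropy:
\<open>ln m * P\<^sub>\<theta>(B \<theta>) \<le> KL(P\<^sub>\<theta>, P\<^sub>\<psi>) + ln 2\<close> (\<open>ln_mult_prob_le_relative_entropy\<close>). This replaces
Fano's inequality: one alternative is compared with the centre, and no mutual information is formed.

In an exponential family the relative entropy is the Bregman divergence of \<open>A\<close>, because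
\<open>T\<close> has mean \<open>A'(\<theta>)\<close> (\<open>expectation_sufficient_statistic\<close>). Taylor's theorem bounds each coordinate's
divergence by \<open>C(M) / 2\<close> times the squared difference, and entropies of independent coordinates add up,
so \<open>KL(P\<^sub>\<theta>, P\<^sub>\<psi>) \<le> \<kappa> / 2\<close>. Hence \<open>P\<^sub>\<theta>(B \<theta>) \<le> (\<kappa> / 2 + ln 2) / ln m \<le> 3 / 8\<close>. With probability
at least \<open>1 / 2\<close> the estimator therefore misses \<open>\<theta>\<close> by \<open>\<delta> / 2\<close>, which gives risk at least
\<open>(\<delta> / 2)\<^sup>2 / 2 = \<epsilon>\<^sup>2 / (8c\<^sup>2)\<close>.
\<close>

section \<open>Packings\<close>

lemma euclid_dist_commute: "euclid_dist n x y = euclid_dist n y x"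
  unfolding euclid_dist_def L2_set_def by (simp add: power2_commute)

lemma euclid_dist_triangle: "euclid_dist n x z \<le> euclid_dist n x y + euclid_dist n y z"
  using L2_set_triangle_ineq[of "\<lambda>i. x i - y i" "\<lambda>i. y i - z i" "{..<n}"]
  unfolding euclid_dist_def by simp

lemma euclid_dist_power2: "(euclid_dist n x y)\<^sup>2 = (\<Sum>i<n. (x i - y i)\<^sup>2)"
  unfolding euclid_dist_def L2_set_def by (simp add: sum_nonneg)

lemma euclid_dist_nonneg: "0 \<le> euclid_dist n x y"
  by (simp add: euclid_dist_def L2_set_nonneg)

lemma euclid_dist_self: "euclid_dist n x x = 0"
  by (simp add: euclid_dist_def L2_set_def)

lemma measurable_euclid_dist [measurable]:
  assumes [measurable]: "f \<in> N \<rightarrow>\<^sub>M (\<Pi>\<^sub>M i\<in>{..<n}. borel)"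
  shows "(\<lambda>y. euclid_dist n (f y) x) \<in> borel_measurable N"
  unfolding euclid_dist_def L2_set_def by measurable

text \<open>Greedy choice: as long as fewer points than the covering number have been chosen, they do not
  cover \<open>S\<close>, and any uncovered point can be added to the packing.\<close>

lemma exists_packing_of_covering_number:
  assumes "enat m \<le> covering_number n \<delta> S" and "\<delta> > 0"
  shows "\<exists>P\<subseteq>S. finite P \<and> card P = m \<and> (\<forall>x\<in>P. \<forall>y\<in>P. x \<noteq> y \<longrightarrow> \<delta> < euclid_dist n x y)"
  using assms(1)
proof (induction m)
  case 0
  show ?case by (intro exI[of _ "{}"]) auto
next
  case (Suc m)
  have "enat m \<le> covering_number n \<delta> S"
    by (rule order_trans[OF _ Suc.prems]) simp
  then obtain P where P: "P \<subseteq> S" "finite P" "card P = m"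
    "\<And>x y. x \<in> P \<Longrightarrow> y \<in> P \<Longrightarrow> x \<noteq> y \<Longrightarrow> \<delta> < euclid_dist n x y"
    using Suc.IH by blast
  have "\<not> is_covering n \<delta> S P"
  proof
    assume "is_covering n \<delta> S P"
    then have "covering_number n \<delta> S \<le> enat (card P)"
      unfolding covering_number_def using P(2) by (intro INF_lower) auto
    with Suc.prems have "enat (Suc m) \<le> enat (card P)"
      by (rule order_trans)
    then show False using P(3) by simp
  qed
  then obtain x where x: "x \<in> S" "\<And>y. y \<in> P \<Longrightarrow> \<delta> < euclid_dist n x y"
    using P(1) unfolding is_covering_def by (auto simp: not_le)
  have "x \<notin> P"
    using x(2)[of x] assms(2) by (auto simp: euclid_dist_self)
  moreover have "\<delta> < euclid_dist n y x" if "y \<in> P" for y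
    using x(2)[OF that] by (subst euclid_dist_commute)
  ultimately show ?case
    using P x by (intro exI[of _ "insert x P"]) auto
qed

text \<open>The supremum that defines the local covering number may be infinite, and then need not be attained.
  So a natural number \<open>m\<close> below it with \<open>a < ln m\<close> is fixed first, and a centre whose covering
  number reaches \<open>m\<close> is chosen afterwards.\<close>

lemma exists_packing_of_local_covering_number:
  assumes "ereal a < log_enat (local_covering_number n K \<epsilon> c)" and "0 \<le> a" and "\<epsilon> / c > 0"
  obtains \<psi> P where "\<psi> \<in> K" "P \<subseteq> euclid_cball n \<psi> \<epsilon> \<inter> K" "finite P" "a < ln (real (card P))"
    "\<And>x y. x \<in> P \<Longrightarrow> y \<in> P \<Longrightarrow> x \<noteq> y \<Longrightarrow> \<epsilon> / c < euclid_dist n x y"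
proof -
  have "\<exists>m>0. enat m \<le> local_covering_number n K \<epsilon> c \<and> a < ln (real m)"
  proof (cases "local_covering_number n K \<epsilon> c")
    case (enat k)
    then show ?thesis
      using assms(1,2) by (intro exI[of _ k] conjI) (cases "k = 0"; simp add: log_enat_def)+
  next
    case infinity
    obtain m :: nat where m: "exp a < real m"
      using reals_Archimedean2 by blast
    then have "0 < real m"
      by (rule less_trans[OF exp_gt_zero])
    moreover have "a < ln (real m)"
      using m \<open>0 < real m\<close> ln_less_cancel_iff[of "exp a" "real m"] by simp
    ultimately show ?thesis
      using infinity by (intro exI[of _ m]) auto
  qed
  then obtain m where m: "m > 0" "enat m \<le> local_covering_number n K \<epsilon> c" "a < ln (real m)"
    by blast
  \<comment> \<open>A strict bound, as needed to find a centre below a supremum that need not be attained.\<close>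
  have "enat (m - 1) < local_covering_number n K \<epsilon> c"
    using m(1,2) by (intro less_le_trans[OF _ m(2)]) simp
  then obtain \<psi> where \<psi>: "\<psi> \<in> K"
    "enat (m - 1) < covering_number n (\<epsilon> / c) (euclid_cball n \<psi> \<epsilon> \<inter> K)"
    unfolding local_covering_number_def less_SUP_iff by blast
  have "enat m \<le> covering_number n (\<epsilon> / c) (euclid_cball n \<psi> \<epsilon> \<inter> K)"
    using \<psi>(2) m(1) Suc_ile_eq[of "m - 1"] by simp
  from exists_packing_of_covering_number[OF this assms(3)]
  obtain P where P: "P \<subseteq> euclid_cball n \<psi> \<epsilon> \<inter> K" "finite P" "card P = m"
    "\<forall>x\<in>P. \<forall>y\<in>P. x \<noteq> y \<longrightarrow> \<epsilon> / c < euclid_dist n x y"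
    by (elim exE conjE)
  show ?thesis
    using P m(3) by (intro that[OF \<psi>(1), of P]) simp_all
qed

section \<open>Change of measure\<close>

text \<open>Jensen's inequality in a form that allows \<open>exp \<circ> X\<close> to have infinite integral; in both uses
  below \<open>exp \<circ> X\<close> is a bounded multiple of a density ratio, so that a change of measure evaluates or
  bounds the right-hand side.\<close>

lemma (in prob_space) exp_expectation_le_nn_integral:
  fixes X :: "'a \<Rightarrow> real"
  assumes X: "integrable M X"
  shows "ennreal (exp (expectation X)) \<le> (\<integral>\<^sup>+x. ennreal (exp (X x)) \<partial>M)"
proof (cases "(\<integral>\<^sup>+x. ennreal (exp (X x)) \<partial>M) < \<infinity>")
  case True
  have [measurable]: "X \<in> borel_measurable M" using X by simp
  have int: "integrable M (\<lambda>x. exp (X x))"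
    using True by (intro integrableI_bounded) auto
  have "exp (expectation X) \<le> expectation (\<lambda>x. exp (X x))"
    by (rule jensens_inequality[where I=UNIV]) (use X int in \<open>auto intro: exp_convex\<close>)
  then show ?thesis
    using int by (simp add: nn_integral_eq_integral ennreal_leI)
next
  case False
  then have "(\<integral>\<^sup>+x. ennreal (exp (X x)) \<partial>M) = \<top>"
    using top.not_eq_extremum by (metis infinity_ennreal_def)
  then show ?thesis by simp
qed

text \<open>The variational inequality of Donsker and Varadhan for the test function \<open>ln m * indicator B\<close>.
  Here \<open>l\<close> is the log-likelihood ratio of \<open>M\<close> against \<open>Q\<close>, so \<open>expectation l\<close> is the relative
  entropy. Jensen's inequality bounds \<open>exp (ln m * prob B - expectation l)\<close> by the \<open>Q\<close>-integral of
  \<open>m\<close> on \<open>B\<close> and \<open>1\<close> off \<open>B\<close>, which is at most \<open>2\<close>.\<close>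

lemma (in prob_space) ln_mult_prob_le_relative_entropy:
  fixes l :: "'a \<Rightarrow> real"
  assumes l: "integrable M l"
    and Q: "Q = density M (\<lambda>x. ennreal (exp (- l x)))" "prob_space Q"
    and B: "B \<in> sets M" and m: "m > 0" "measure Q B \<le> 1 / m"
  shows "ln m * prob B \<le> expectation l + ln 2"
proof -
  interpret Q: prob_space Q by (rule Q(2))
  have [measurable]: "l \<in> borel_measurable M" "B \<in> sets M" "B \<in> sets Q"
    using l B Q(1) by auto
  define X where "X = (\<lambda>x. ln m * indicator B x - l x)"
  have int: "integrable M X"
    unfolding X_def using l by (intro Bochner_Integration.integrable_diff integrable_mult_right integrable_real_indicator)
      (auto simp: less_top[symmetric])
  have EX: "expectation X = ln m * prob B - expectation l"
    unfolding X_def using l by (subst Bochner_Integration.integral_diff) (auto simp: less_top[symmetric])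
  have "(\<integral>\<^sup>+x. ennreal (exp (X x)) \<partial>M) \<le>
      (\<integral>\<^sup>+x. ennreal (exp (- l x)) * (ennreal m * indicator B x + 1) \<partial>M)"
  proof (rule nn_integral_mono)
    fix x
    show "ennreal (exp (X x)) \<le> ennreal (exp (- l x)) * (ennreal m * indicator B x + 1)"
    proof (cases "x \<in> B")
      case True
      have "exp (X x) = exp (- l x) * m"
        using True m(1) by (simp add: X_def exp_diff exp_minus field_simps)
      also have "\<dots> \<le> exp (- l x) * (m + 1)" by simp
      finally have "ennreal (exp (X x)) \<le> ennreal (exp (- l x) * (m + 1))"
        by (rule ennreal_leI)
      then show ?thesis
        using True m(1) by (simp add: ennreal_mult)
    next
      case False
      then show ?thesis by (simp add: X_def)
    qed
  qed
  also have "\<dots> = (\<integral>\<^sup>+x. ennreal m * indicator B x + 1 \<partial>Q)"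
    unfolding Q(1) by (subst nn_integral_density) auto
  also have "\<dots> = ennreal m * emeasure Q B + 1"
    by (subst nn_integral_add) (auto simp: nn_integral_cmult Q.emeasure_space_1)
  also have "\<dots> = ennreal (m * measure Q B + 1)"
    using m(1) by (simp add: Q.emeasure_eq_measure ennreal_mult)
  also have "\<dots> \<le> ennreal 2"
    using m by (intro ennreal_leI) (simp add: field_simps)
  finally have "ennreal (exp (expectation X)) \<le> ennreal 2"
    using exp_expectation_le_nn_integral[OF int] by (rule order.trans[rotated])
  then have "exp (expectation X) \<le> 2"
    by (simp del: ennreal_numeral)
  then have "expectation X \<le> ln 2"
    by (simp add: ln_ge_iff)
  then show ?thesis using EX by simp
qed

lemma density_PiM:
  fixes f :: "'i \<Rightarrow> 'a \<Rightarrow> ennreal"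
  assumes I: "finite I"
    and M: "\<And>i. i \<in> I \<Longrightarrow> prob_space (M i)"
    and f: "\<And>i. i \<in> I \<Longrightarrow> f i \<in> borel_measurable (M i)"
    and D: "\<And>i. i \<in> I \<Longrightarrow> prob_space (density (M i) (f i))"
  shows "density (\<Pi>\<^sub>M i\<in>I. M i) (\<lambda>x. \<Prod>i\<in>I. f i (x i)) = (\<Pi>\<^sub>M i\<in>I. density (M i) (f i))"
proof -
  \<comment> \<open>The product measure locale asks for a sigma-finite measure at every index, so the families are
    extended by trivial ones outside \<open>I\<close>.\<close>
  define M' where "M' i = (if i \<in> I then M i else count_space {})" for i
  define f' where "f' i = (if i \<in> I then f i else (\<lambda>_. 0))" for i
  have M'I: "M' i = M i" "f' i = f i" if "i \<in> I" for i
    using that by (simp_all add: M'_def f'_def)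
  have [measurable]: "f' i \<in> borel_measurable (M' i)" for i
    using f by (auto simp: M'_def f'_def)
  have sf0: "sigma_finite_measure (M' i)" for i
    using M by (auto simp: M'_def prob_space_imp_sigma_finite
        intro: sigma_finite_measure_count_space_countable)
  have sfD: "sigma_finite_measure (density (M' i) (f' i))" for i
  proof (cases "i \<in> I")
    case True
    then show ?thesis using D by (simp add: M'I prob_space_imp_sigma_finite)
  next
    case False
    have "density (M' i) (f' i) = count_space {}"
      using False by (intro measure_eqI) (auto simp: M'_def f'_def)
    then show ?thesis by (simp add: sigma_finite_measure_count_space_countable)
  qed
  interpret P: product_sigma_finite M' using sf0 by (rule product_sigma_finite.intro)
  interpret R: product_sigma_finite "\<lambda>i. density (M' i) (f' i)" using sfD by (rule product_sigma_finite.intro)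
  have m: "(\<lambda>x. \<Prod>i\<in>I. f' i (x i)) \<in> borel_measurable (Pi\<^sub>M I M')"
    by (intro borel_measurable_prod_ennreal measurable_compose[OF measurable_component_singleton]) auto
  have "density (Pi\<^sub>M I M') (\<lambda>x. \<Prod>i\<in>I. f' i (x i)) = (\<Pi>\<^sub>M i\<in>I. density (M' i) (f' i))"
  proof (rule R.PiM_eqI[OF I])
    show "sets (density (Pi\<^sub>M I M') (\<lambda>x. \<Prod>i\<in>I. f' i (x i))) =
        sets (\<Pi>\<^sub>M i\<in>I. density (M' i) (f' i))"
      by (auto intro!: sets_PiM_cong)
  next
    fix A assume "\<And>i. i \<in> I \<Longrightarrow> A i \<in> sets (density (M' i) (f' i))"
    then have A: "\<And>i. i \<in> I \<Longrightarrow> A i \<in> sets (M' i)" by simp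
    have "emeasure (density (Pi\<^sub>M I M') (\<lambda>x. \<Prod>i\<in>I. f' i (x i))) (Pi\<^sub>E I A) =
        (\<integral>\<^sup>+x. (\<Prod>i\<in>I. f' i (x i)) * indicator (Pi\<^sub>E I A) x \<partial>Pi\<^sub>M I M')"
      using I A m by (subst emeasure_density) (auto intro!: sets_PiM_I_finite)
    also have "\<dots> = (\<integral>\<^sup>+x. (\<Prod>i\<in>I. f' i (x i) * indicator (A i) (x i)) \<partial>Pi\<^sub>M I M')"
    proof (rule nn_integral_cong)
      fix x assume "x \<in> space (Pi\<^sub>M I M')"
      then have "indicator (Pi\<^sub>E I A) x = (\<Prod>i\<in>I. indicator (A i) (x i) :: ennreal)"
        using I by (auto simp: indicator_def PiE_iff space_PiM)
      then show "(\<Prod>i\<in>I. f' i (x i)) * indicator (Pi\<^sub>E I A) x =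
          (\<Prod>i\<in>I. f' i (x i) * indicator (A i) (x i))"
        by (simp add: prod.distrib)
    qed
    also have "\<dots> = (\<Prod>i\<in>I. \<integral>\<^sup>+x. f' i x * indicator (A i) x \<partial>M' i)"
      using I A by (intro P.product_nn_integral_prod) auto
    also have "\<dots> = (\<Prod>i\<in>I. emeasure (density (M' i) (f' i)) (A i))"
      using A by (intro prod.cong) (auto simp: emeasure_density)
    finally show "emeasure (density (Pi\<^sub>M I M') (\<lambda>x. \<Prod>i\<in>I. f' i (x i))) (Pi\<^sub>E I A) =
        (\<Prod>i\<in>I. emeasure (density (M' i) (f' i)) (A i))" .
  qed
  moreover have "Pi\<^sub>M I M' = Pi\<^sub>M I M"
    by (rule PiM_cong) (auto simp: M'I)
  moreover have "(\<Pi>\<^sub>M i\<in>I. density (M' i) (f' i)) = (\<Pi>\<^sub>M i\<in>I. density (M i) (f i))"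
    by (rule PiM_cong) (auto simp: M'I)
  moreover have "(\<lambda>x. \<Prod>i\<in>I. f' i (x i)) = (\<lambda>x. \<Prod>i\<in>I. f i (x i))"
    by (intro ext prod.cong) (auto simp: M'I)
  ultimately show ?thesis by simp
qed

lemma
  fixes g :: "'a \<Rightarrow> real"
  assumes M: "\<And>i. i \<in> I \<Longrightarrow> prob_space (M i)" and i: "i \<in> I" and g: "integrable (M i) g"
  shows integrable_PiM_component: "integrable (\<Pi>\<^sub>M i\<in>I. M i) (\<lambda>x. g (x i))"
    and integral_PiM_component: "(\<integral>x. g (x i) \<partial>(\<Pi>\<^sub>M i\<in>I. M i)) = (\<integral>x. g x \<partial>M i)"
proof -
  have [measurable]: "(\<lambda>x. x i) \<in> Pi\<^sub>M I M \<rightarrow>\<^sub>M M i" "g \<in> borel_measurable (M i)"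
    using i g by (auto intro: measurable_component_singleton)
  have d: "distr (Pi\<^sub>M I M) (M i) (\<lambda>x. x i) = M i"
    using M i by (rule distr_PiM_component)
  show "integrable (\<Pi>\<^sub>M i\<in>I. M i) (\<lambda>x. g (x i))"
    using g by (subst (asm) d[symmetric]) (simp add: integrable_distr_eq)
  show "(\<integral>x. g (x i) \<partial>(\<Pi>\<^sub>M i\<in>I. M i)) = (\<integral>x. g x \<partial>M i)"
    by (subst d[symmetric]) (simp add: integral_distr)
qed

section \<open>Exponential families\<close>

text \<open>The logarithm of the density at \<open>\<theta>\<close> divided by the density at \<open>\<psi>\<close>; the common factor \<open>h\<close>
  cancels, and where it vanishes this formula fixes the value.\<close>

definition log_ratio :: "(real \<Rightarrow> real) \<Rightarrow> (real \<Rightarrow> real) \<Rightarrow> real \<Rightarrow> real \<Rightarrow> real \<Rightarrow> real" where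
  "log_ratio T A \<theta> \<psi> y = (\<theta> - \<psi>) * T y - A \<theta> + A \<psi>"

lemma space_exp_law [simp]: "space (exp_law h T A \<theta>) = UNIV"
  and sets_exp_law [simp, measurable_cong]: "sets (exp_law h T A \<theta>) = sets borel"
  by (simp_all add: exp_law_def)

lemma exp_law_eq_density:
  assumes "regular_exp_family h T A"
  shows "exp_law h T A \<psi> =
    density (exp_law h T A \<theta>) (\<lambda>y. ennreal (exp (- log_ratio T A \<theta> \<psi> y)))"
proof -
  have [measurable]: "h \<in> borel_measurable borel" "T \<in> borel_measurable borel"
    and h: "\<And>y. 0 \<le> h y"
    using assms by (auto simp: regular_exp_family_def)
  have "exp_density h T A \<psi> y = exp_density h T A \<theta> y * exp (- log_ratio T A \<theta> \<psi> y)" for y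
    by (simp add: exp_density_def log_ratio_def exp_add[symmetric] algebra_simps)
  then show ?thesis
    unfolding exp_law_def using h
    by (subst density_density_eq)
      (auto simp: log_ratio_def exp_density_def ennreal_mult[symmetric] intro!: density_cong)
qed

text \<open>Integrability is hidden in the positive variance: the integral of a nonintegrable function is \<open>0\<close>, so
  \<open>(T - \<mu>)\<^sup>2\<close> is integrable, and thus also \<open>T\<close>. The mean is found without differentiating under
  the integral: Jensen's inequality, applied to the total mass \<open>1\<close> of the law at \<open>\<psi>\<close> written as an
  integral over the law at \<open>\<theta>\<close>, says that the mean \<open>\<mu>\<close> is a subgradient of \<open>A\<close> at \<open>\<theta>\<close>. At an interior
  point where \<open>A\<close> is differentiable, the only subgradient is the derivative.\<close>

lemma
  assumes reg: "regular_exp_family h T A" and \<theta>: "\<theta> \<in> natural_domain h T"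
  shows integrable_sufficient_statistic: "integrable (exp_law h T A \<theta>) T"
    and expectation_sufficient_statistic: "(\<integral>y. T y \<partial>exp_law h T A \<theta>) = deriv A \<theta>"
proof -
  have [measurable]: "T \<in> borel_measurable borel"
    and "open (natural_domain h T)"
    and A: "A differentiable (at \<theta>)"
    and var: "prob_space.variance (exp_law h T A \<theta>) T > 0"
    and prob: "\<And>\<psi>. \<psi> \<in> natural_domain h T \<Longrightarrow> prob_space (exp_law h T A \<psi>)"
    using reg \<theta> by (auto simp: regular_exp_family_def)
  interpret prob_space "exp_law h T A \<theta>" by (rule prob[OF \<theta>])
  define \<mu> where "\<mu> = expectation T"
  have "integrable (exp_law h T A \<theta>) (\<lambda>y. (T y - \<mu>)\<^sup>2)" (is ?int)
  proof (rule ccontr)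
    assume "\<not> ?int"
    then have "variance T = 0"
      unfolding \<mu>_def by (rule not_integrable_integral_eq)
    with var show False by (simp only: less_irrefl)
  qed
  then have "integrable (exp_law h T A \<theta>) (\<lambda>y. T y - \<mu>)"
    by (rule square_integrable_imp_integrable[rotated]) measurable
  then have "integrable (exp_law h T A \<theta>) (\<lambda>y. (T y - \<mu>) + \<mu>)"
    by (rule Bochner_Integration.integrable_add) simp
  then show int: "integrable (exp_law h T A \<theta>) T" by simp
  have subgradient: "(\<psi> - \<theta>) * \<mu> \<le> A \<psi> - A \<theta>" if \<psi>: "\<psi> \<in> natural_domain h T" for \<psi>
  proof -
    have i: "integrable (exp_law h T A \<theta>) (\<lambda>y. - log_ratio T A \<theta> \<psi> y)"
      unfolding log_ratio_def using int by auto
    have [measurable]: "log_ratio T A \<theta> \<psi> \<in> borel_measurable borel"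
      unfolding log_ratio_def by measurable
    have e: "expectation (\<lambda>y. - log_ratio T A \<theta> \<psi> y) = (\<psi> - \<theta>) * \<mu> - A \<psi> + A \<theta>"
      unfolding log_ratio_def \<mu>_def using int by (simp add: prob_space[simplified] algebra_simps)
    have "ennreal (exp ((\<psi> - \<theta>) * \<mu> - A \<psi> + A \<theta>)) \<le>
        (\<integral>\<^sup>+y. ennreal (exp (- log_ratio T A \<theta> \<psi> y)) \<partial>exp_law h T A \<theta>)"
      using exp_expectation_le_nn_integral[OF i] unfolding e .
    also have "\<dots> = emeasure (exp_law h T A \<psi>) UNIV"
      by (subst exp_law_eq_density[OF reg, of \<psi> \<theta>]) (subst emeasure_density, auto)
    also have "\<dots> = 1"
      using prob_space.emeasure_space_1[OF prob[OF \<psi>]] by simp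
    finally show ?thesis by simp
  qed
  obtain d where d: "d > 0" "ball \<theta> d \<subseteq> natural_domain h T"
    using \<open>open _\<close> \<theta> open_contains_ball by blast
  have "(A has_real_derivative deriv A \<theta>) (at \<theta>)"
    using A by (simp add: DERIV_deriv_iff_real_differentiable)
  then have "((\<lambda>\<psi>. A \<psi> - (\<psi> - \<theta>) * \<mu>) has_real_derivative deriv A \<theta> - \<mu>) (at \<theta>)"
    by (auto intro!: derivative_eq_intros)
  moreover have "\<forall>\<psi>. \<bar>\<theta> - \<psi>\<bar> < d \<longrightarrow> A \<theta> - (\<theta> - \<theta>) * \<mu> \<le> A \<psi> - (\<psi> - \<theta>) * \<mu>"
  proof (intro allI impI)
    fix \<psi> assume "\<bar>\<theta> - \<psi>\<bar> < d"
    then have "\<psi> \<in> natural_domain h T"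
      using d(2) by (auto simp: dist_real_def)
    from subgradient[OF this] show "A \<theta> - (\<theta> - \<theta>) * \<mu> \<le> A \<psi> - (\<psi> - \<theta>) * \<mu>" by simp
  qed
  ultimately have "deriv A \<theta> - \<mu> = 0"
    using d(1) by (intro DERIV_local_min[where f="\<lambda>\<psi>. A \<psi> - (\<psi> - \<theta>) * \<mu>"])
  then show "(\<integral>y. T y \<partial>exp_law h T A \<theta>) = deriv A \<theta>"
    by (simp add: \<mu>_def)
qed

lemma
  assumes reg: "regular_exp_family h T A" and \<theta>: "\<theta> \<in> natural_domain h T"
  shows integrable_log_ratio: "integrable (exp_law h T A \<theta>) (log_ratio T A \<theta> \<psi>)"
    and expectation_log_ratio:
      "(\<integral>y. log_ratio T A \<theta> \<psi> y \<partial>exp_law h T A \<theta>) = A \<psi> - A \<theta> - deriv A \<theta> * (\<psi> - \<theta>)"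
proof -
  interpret prob_space "exp_law h T A \<theta>"
    using reg \<theta> by (simp add: regular_exp_family_def)
  show "integrable (exp_law h T A \<theta>) (log_ratio T A \<theta> \<psi>)"
    unfolding log_ratio_def using integrable_sufficient_statistic[OF reg \<theta>] by auto
  show "(\<integral>y. log_ratio T A \<theta> \<psi> y \<partial>exp_law h T A \<theta>) = A \<psi> - A \<theta> - deriv A \<theta> * (\<psi> - \<theta>)"
    unfolding log_ratio_def
    using integrable_sufficient_statistic[OF reg \<theta>] expectation_sufficient_statistic[OF reg \<theta>]
    by (simp add: prob_space[simplified] algebra_simps)
qed

text \<open>Taylor's theorem of order two with Lagrange remainder, whose intermediate point stays in \<open>[-M, M]\<close>.
  Continuity on this compact interval makes the supremum in \<open>max_curvature\<close> a genuine upper bound.\<close>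

lemma bregman_divergence_le_max_curvature:
  assumes A: "\<And>\<theta>. \<theta> \<in> {-M..M} \<Longrightarrow> A differentiable (at \<theta>)"
    and A': "\<And>\<theta>. \<theta> \<in> {-M..M} \<Longrightarrow> deriv A differentiable (at \<theta>)"
    and cont: "continuous_on {-M..M} (deriv (deriv A))"
    and \<theta>: "\<theta> \<in> {-M..M}" and \<psi>: "\<psi> \<in> {-M..M}"
  shows "A \<psi> - A \<theta> - deriv A \<theta> * (\<psi> - \<theta>) \<le> max_curvature A M / 2 * (\<psi> - \<theta>)\<^sup>2"
proof (cases "\<psi> = \<theta>")
  case False
  define D where "D m = (if m = 0 then A else if m = Suc 0 then deriv A else deriv (deriv A))"
    for m :: nat
  have "\<exists>t. (if \<psi> < \<theta> then \<psi> < t \<and> t < \<theta> else \<theta> < t \<and> t < \<psi>) \<and>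
      A \<psi> = (\<Sum>m<2. D m \<theta> / fact m * (\<psi> - \<theta>) ^ m) + D 2 t / fact 2 * (\<psi> - \<theta>) ^ 2"
  proof (rule Taylor)
    show "\<forall>m t. m < 2 \<and> - M \<le> t \<and> t \<le> M \<longrightarrow> DERIV (D m) t :> D (Suc m) t"
      using A A' by (auto simp: D_def less_2_cases_iff DERIV_deriv_iff_real_differentiable)
  qed (use \<theta> \<psi> False in \<open>auto simp: D_def\<close>)
  then obtain t where t: "if \<psi> < \<theta> then \<psi> < t \<and> t < \<theta> else \<theta> < t \<and> t < \<psi>"
    and eq: "A \<psi> = (\<Sum>m<2. D m \<theta> / fact m * (\<psi> - \<theta>) ^ m) + D 2 t / fact 2 * (\<psi> - \<theta>) ^ 2"
    by blast
  have "t \<in> {-M..M}"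
    using t \<theta> \<psi> by (auto split: if_splits)
  moreover have "bdd_above (deriv (deriv A) ` {-M..M})"
    by (intro bounded_imp_bdd_above compact_imp_bounded compact_continuous_image cont) simp
  ultimately have "deriv (deriv A) t \<le> max_curvature A M"
    unfolding max_curvature_def by (intro cSUP_upper)
  then have "deriv (deriv A) t / 2 * (\<psi> - \<theta>)\<^sup>2 \<le> max_curvature A M / 2 * (\<psi> - \<theta>)\<^sup>2"
    by (intro mult_right_mono) auto
  moreover have "A \<psi> - A \<theta> - deriv A \<theta> * (\<psi> - \<theta>) = deriv (deriv A) t / 2 * (\<psi> - \<theta>)\<^sup>2"
    using eq by (simp add: D_def numeral_2_eq_2)
  ultimately show ?thesis by simp
qed simp

text \<open>The tensorised form of the facts about \<open>log_ratio\<close>: log-likelihood ratios of independent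
  observations add up, and so do their expectations.\<close>

lemma
  fixes \<theta> \<psi> :: "nat \<Rightarrow> real"
  assumes reg: "regular_exp_family h T A" and I: "finite I"
    and \<theta>: "\<And>i. i \<in> I \<Longrightarrow> \<theta> i \<in> natural_domain h T"
    and \<psi>: "\<And>i. i \<in> I \<Longrightarrow> \<psi> i \<in> natural_domain h T"
  defines "l \<equiv> (\<lambda>y. \<Sum>i\<in>I. log_ratio T A (\<theta> i) (\<psi> i) (y i))"
  defines "P \<equiv> \<Pi>\<^sub>M i\<in>I. exp_law h T A (\<theta> i)"
  shows PiM_exp_law_eq_density:
      "(\<Pi>\<^sub>M i\<in>I. exp_law h T A (\<psi> i)) = density P (\<lambda>y. ennreal (exp (- l y)))"
    and integrable_sum_log_ratio: "integrable P l"
    and expectation_sum_log_ratio: "(\<integral>y. l y \<partial>P) =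
      (\<Sum>i\<in>I. A (\<psi> i) - A (\<theta> i) - deriv A (\<theta> i) * (\<psi> i - \<theta> i))"
proof -
  have [measurable]: "T \<in> borel_measurable borel"
    and prob: "\<And>\<theta>. \<theta> \<in> natural_domain h T \<Longrightarrow> prob_space (exp_law h T A \<theta>)"
    using reg by (auto simp: regular_exp_family_def)
  let ?f = "\<lambda>i y. ennreal (exp (- log_ratio T A (\<theta> i) (\<psi> i) y))"
  have eq: "exp_law h T A (\<psi> i) = density (exp_law h T A (\<theta> i)) (?f i)" for i
    by (rule exp_law_eq_density[OF reg])
  have [measurable]: "log_ratio T A a b \<in> borel_measurable borel" for a b
    unfolding log_ratio_def by measurable
  have "(\<Pi>\<^sub>M i\<in>I. exp_law h T A (\<psi> i)) = (\<Pi>\<^sub>M i\<in>I. density (exp_law h T A (\<theta> i)) (?f i))"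
    by (subst eq) (rule refl)
  also have "\<dots> = density P (\<lambda>y. \<Prod>i\<in>I. ?f i (y i))"
    unfolding P_def using I \<theta> \<psi> prob
    by (intro density_PiM[symmetric]) (auto simp: eq[symmetric])
  also have "(\<lambda>y. \<Prod>i\<in>I. ?f i (y i)) = (\<lambda>y. ennreal (exp (- l y)))"
    using I by (simp add: l_def prod_ennreal exp_sum sum_negf[symmetric] del: sum_negf)
  finally show "(\<Pi>\<^sub>M i\<in>I. exp_law h T A (\<psi> i)) = density P (\<lambda>y. ennreal (exp (- l y)))" .
  have int: "integrable P (\<lambda>y. log_ratio T A (\<theta> i) (\<psi> i) (y i))" if "i \<in> I" for i
    unfolding P_def using that \<theta> prob
    by (intro integrable_PiM_component integrable_log_ratio reg) auto
  then show "integrable P l"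
    unfolding l_def by (intro Bochner_Integration.integrable_sum)
  have "(\<integral>y. l y \<partial>P) = (\<Sum>i\<in>I. \<integral>y. log_ratio T A (\<theta> i) (\<psi> i) (y i) \<partial>P)"
    unfolding l_def using int by (intro Bochner_Integration.integral_sum)
  also have "\<dots> = (\<Sum>i\<in>I. \<integral>y. log_ratio T A (\<theta> i) (\<psi> i) y \<partial>exp_law h T A (\<theta> i))"
    unfolding P_def using \<theta> prob
    by (intro sum.cong refl integral_PiM_component integrable_log_ratio reg) auto
  also have "\<dots> = (\<Sum>i\<in>I. A (\<psi> i) - A (\<theta> i) - deriv A (\<theta> i) * (\<psi> i - \<theta> i))"
    using \<theta> by (intro sum.cong refl expectation_log_ratio reg)
  finally show "(\<integral>y. l y \<partial>P) =
      (\<Sum>i\<in>I. A (\<psi> i) - A (\<theta> i) - deriv A (\<theta> i) * (\<psi> i - \<theta> i))" .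
qed

section \<open>Lower bound on the risk\<close>

lemma (in prob_space) exists_prob_le_inverse_card:
  assumes "finite S" "S \<noteq> {}" "B ` S \<subseteq> events" "disjoint_family_on B S"
  shows "\<exists>j\<in>S. prob (B j) \<le> 1 / real (card S)"
proof (rule ccontr)
  assume "\<not> ?thesis"
  then have "(\<Sum>j\<in>S. 1 / real (card S)) < (\<Sum>j\<in>S. prob (B j))"
    using assms(1,2) by (intro sum_strict_mono) auto
  also have "\<dots> = prob (\<Union>j\<in>S. B j)"
    using assms by (intro finite_measure_finite_Union[symmetric])
  finally show False
    using assms(1,2) prob_le_1[of "\<Union>j\<in>S. B j"] by simp
qed

theorem lemma2p3:
  "\<exists>c0>0. \<forall>c\<ge>c0. \<forall>(n::nat) (h::real \<Rightarrow> real) (T::real \<Rightarrow> real) (A::real \<Rightarrow> real) (M::real)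
      (K::(nat \<Rightarrow> real) set) (\<epsilon>::real).
     n \<ge> 1 \<longrightarrow>
     regular_exp_family h T A \<longrightarrow>
     M > 0 \<longrightarrow> {-2*M..2*M} \<subseteq> natural_domain h T \<longrightarrow>
     K \<subseteq> ({..<n} \<rightarrow>\<^sub>E {-M..M}) \<longrightarrow> star_shaped n K \<longrightarrow>
     \<epsilon> > 0 \<longrightarrow>
     log_enat (local_covering_number n K \<epsilon> c) > ereal (4 * max (max_curvature A M * \<epsilon>\<^sup>2) (ln 2)) \<longrightarrow>
     minimax_risk n h T A K \<ge> ennreal (\<epsilon>\<^sup>2 / (8 * c\<^sup>2))"
  \<comment> \<open>The constant \<open>c\<close> enters only through the scale \<open>\<epsilon> / c\<close>, so the threshold merely has to make it positive.\<close>
proof (intro exI[of _ 1] conjI allI impI)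
  fix c :: real and n :: nat and h T A :: "real \<Rightarrow> real" and M :: real
    and K :: "(nat \<Rightarrow> real) set" and \<epsilon> :: real
  assume c: "c \<ge> 1" and reg: "regular_exp_family h T A" and M: "M > 0"
    and dom: "{-2*M..2*M} \<subseteq> natural_domain h T"
    and K: "K \<subseteq> ({..<n} \<rightarrow>\<^sub>E {-M..M})" and \<epsilon>: "\<epsilon> > 0"
    and cov: "log_enat (local_covering_number n K \<epsilon> c) >
      ereal (4 * max (max_curvature A M * \<epsilon>\<^sup>2) (ln 2))"
  define \<kappa> where "\<kappa> = max (max_curvature A M * \<epsilon>\<^sup>2) (ln 2)"
  define \<delta> where "\<delta> = \<epsilon> / c"
  have \<delta>: "\<delta> > 0" using \<epsilon> c by (simp add: \<delta>_def)
  have \<kappa>: "0 < ln (2::real)" "ln 2 \<le> \<kappa>" "max_curvature A M * \<epsilon>\<^sup>2 \<le> \<kappa>"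
    by (simp_all add: \<kappa>_def)
  then have \<kappa>_pos: "0 < \<kappa>" by linarith
  have "0 \<le> 4 * max (max_curvature A M * \<epsilon>\<^sup>2) (ln 2)"
    using \<kappa>_pos unfolding \<kappa>_def by linarith
  from exists_packing_of_local_covering_number[OF cov this] \<delta>
  obtain \<psi> S where \<psi>: "\<psi> \<in> K" and S: "S \<subseteq> euclid_cball n \<psi> \<epsilon> \<inter> K" "finite S"
    and card: "4 * \<kappa> < ln (real (card S))"
    and sep: "\<And>x y. x \<in> S \<Longrightarrow> y \<in> S \<Longrightarrow> x \<noteq> y \<Longrightarrow> \<delta> < euclid_dist n x y"
    unfolding \<delta>_def \<kappa>_def by metis
  define m where "m = real (card S)"
  have ln_m: "4 * \<kappa> < ln m" using card by (simp add: m_def)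
  have "S \<noteq> {}"
  proof
    assume "S = {}"
    with card \<kappa>_pos show False by simp
  qed
  then have m: "m > 0" using S(2) by (simp add: m_def card_gt_0_iff)
  have KM: "\<theta> i \<in> {-M..M}" if "\<theta> \<in> K" "i < n" for \<theta> i
    using that K by (auto simp: subset_iff PiE_iff)
  have "{-M..M} \<subseteq> natural_domain h T"
    using dom M by (intro order.trans[OF _ dom]) auto
  then have D: "\<theta> i \<in> natural_domain h T" if "\<theta> \<in> K" "i < n" for \<theta> i
    using KM[OF that] by blast
  define law where "law \<theta> = (\<Pi>\<^sub>M i\<in>{..<n}. exp_law h T A (\<theta> i))" for \<theta>
  have sets_law [measurable_cong]: "sets (law \<theta>) = sets (\<Pi>\<^sub>M i\<in>{..<n}. borel)" for \<theta>
    unfolding law_def by (intro sets_PiM_cong) auto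
  have prob_law: "prob_space (law \<theta>)" if "\<theta> \<in> K" for \<theta>
    unfolding law_def using reg D[OF that]
    by (intro prob_space_PiM) (auto simp: regular_exp_family_def)

  show "ennreal (\<epsilon>\<^sup>2 / (8 * c\<^sup>2)) \<le> minimax_risk n h T A K"
    unfolding minimax_risk_def
  proof (rule INF_greatest)
    fix est :: "(nat \<Rightarrow> real) \<Rightarrow> (nat \<Rightarrow> real)"
    assume est [measurable]: "est \<in> (\<Pi>\<^sub>M i\<in>{..<n}. borel) \<rightarrow>\<^sub>M (\<Pi>\<^sub>M i\<in>{..<n}. borel)"
    define B where
      "B \<theta> = {y \<in> space (\<Pi>\<^sub>M i\<in>{..<n}. (borel :: real measure)). euclid_dist n (est y) \<theta> < \<delta> / 2}"
      for \<theta>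
    have B [measurable]: "B \<theta> \<in> sets (\<Pi>\<^sub>M i\<in>{..<n}. borel)" for \<theta>
      unfolding B_def by measurable
    have disj: "disjoint_family_on B S"
      unfolding disjoint_family_on_def
    proof (intro ballI impI)
      fix x y assume xy: "x \<in> S" "y \<in> S" "x \<noteq> y"
      have "euclid_dist n x y \<le> euclid_dist n (est z) x + euclid_dist n (est z) y" for z
        using euclid_dist_triangle[of n x y "est z"] by (simp add: euclid_dist_commute[of n x])
      then show "B x \<inter> B y = {}"
        using sep[OF xy] unfolding B_def by (smt (verit) disjoint_iff field_sum_of_halves mem_Collect_eq)
    qed
    interpret Q: prob_space "law \<psi>" by (rule prob_law[OF \<psi>])
    have "B ` S \<subseteq> Q.events"
      using B by (auto simp: sets_law)
    then obtain \<theta> where \<theta>S: "\<theta> \<in> S" and QB: "measure (law \<psi>) (B \<theta>) \<le> 1 / m"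
      using Q.exists_prob_le_inverse_card[OF S(2) \<open>S \<noteq> {}\<close> _ disj] by (auto simp: m_def)
    have \<theta>: "\<theta> \<in> K" and near: "euclid_dist n \<psi> \<theta> \<le> \<epsilon>"
      using \<theta>S S(1) by (auto simp: euclid_cball_def)
    interpret P: prob_space "law \<theta>" by (rule prob_law[OF \<theta>])
    define l where "l = (\<lambda>y. \<Sum>i<n. log_ratio T A (\<theta> i) (\<psi> i) (y i))"
    have dens: "law \<psi> = density (law \<theta>) (\<lambda>y. ennreal (exp (- l y)))"
      and int: "integrable (law \<theta>) l"
      and kl: "(\<integral>y. l y \<partial>law \<theta>) =
        (\<Sum>i<n. A (\<psi> i) - A (\<theta> i) - deriv A (\<theta> i) * (\<psi> i - \<theta> i))"
      unfolding law_def l_def using D \<theta> \<psi>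
      by (auto intro!: PiM_exp_law_eq_density integrable_sum_log_ratio expectation_sum_log_ratio reg)
    have "(\<integral>y. l y \<partial>law \<theta>) \<le> (\<Sum>i<n. max_curvature A M / 2 * (\<psi> i - \<theta> i)\<^sup>2)"
      unfolding kl
    proof (intro sum_mono bregman_divergence_le_max_curvature)
      show "continuous_on {-M..M} (deriv (deriv A))"
        using reg \<open>{-M..M} \<subseteq> _\<close> by (auto simp: regular_exp_family_def intro: continuous_on_subset)
    qed (use reg \<open>{-M..M} \<subseteq> _\<close> KM \<theta> \<psi> in \<open>auto simp: regular_exp_family_def\<close>)
    also have "\<dots> = max_curvature A M / 2 * (euclid_dist n \<psi> \<theta>)\<^sup>2"
      by (simp add: euclid_dist_power2 sum_distrib_left)
    \<comment> \<open>With nonnegative curvature the bound grows with the distance, which is at most \<open>\<epsilon>\<close>;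
      with negative curvature it is at most \<open>0\<close>, below \<open>\<kappa> / 2\<close>.\<close>
    also have "\<dots> \<le> \<kappa> / 2"
    proof (cases "0 \<le> max_curvature A M")
      case True
      have "(euclid_dist n \<psi> \<theta>)\<^sup>2 \<le> \<epsilon>\<^sup>2"
        using near by (intro power_mono euclid_dist_nonneg)
      then have "max_curvature A M * (euclid_dist n \<psi> \<theta>)\<^sup>2 \<le> max_curvature A M * \<epsilon>\<^sup>2"
        using True by (rule mult_left_mono)
      then show ?thesis using \<kappa>(3) by simp
    next
      case False
      then have "max_curvature A M * (euclid_dist n \<psi> \<theta>)\<^sup>2 \<le> 0"
        by (simp add: mult_nonpos_nonneg)
      then show ?thesis using \<kappa>_pos by simp
    qed
    finally have KL: "(\<integral>y. l y \<partial>law \<theta>) \<le> \<kappa> / 2" .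
    have "ln m * P.prob (B \<theta>) \<le> P.expectation l + ln 2"
      using P.ln_mult_prob_le_relative_entropy[OF int dens prob_law[OF \<psi>] _ m QB] by (simp add: sets_law)
    \<comment> \<open>The sum is at most \<open>\<kappa> / 2 + \<kappa>\<close>, which is below \<open>3 / 8\<close> of \<open>ln m\<close>.\<close>
    also have "\<dots> \<le> ln m * (1 / 2)"
      using KL \<kappa> ln_m by linarith
    finally have "P.prob (B \<theta>) \<le> 1 / 2"
      using ln_m \<kappa> by (subst (asm) mult_le_cancel_left_pos) linarith+
    then have compl: "1 / 2 \<le> P.prob (space (law \<theta>) - B \<theta>)"
      by (subst P.prob_compl) (auto simp: sets_law)
    have "ennreal (\<epsilon>\<^sup>2 / (8 * c\<^sup>2)) = ennreal ((\<delta> / 2)\<^sup>2 * (1 / 2))"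
      by (simp add: \<delta>_def power_divide)
    also have "\<dots> \<le> ennreal ((\<delta> / 2)\<^sup>2 * P.prob (space (law \<theta>) - B \<theta>))"
      using compl by (intro ennreal_leI mult_left_mono) auto
    also have "\<dots> = (\<integral>\<^sup>+y. ennreal ((\<delta> / 2)\<^sup>2) * indicator (space (law \<theta>) - B \<theta>) y \<partial>law \<theta>)"
      by (subst nn_integral_cmult_indicator) (auto simp: P.emeasure_eq_measure ennreal_mult)
    also have "\<dots> \<le> (\<integral>\<^sup>+y. ennreal ((euclid_dist n (est y) \<theta>)\<^sup>2) \<partial>law \<theta>)"
    proof (rule nn_integral_mono)
      fix y assume y: "y \<in> space (law \<theta>)"
      have "space (law \<theta>) = space (\<Pi>\<^sub>M i\<in>{..<n}. (borel :: real measure))"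
        by (rule sets_eq_imp_space_eq[OF sets_law])
      then have "\<delta> / 2 \<le> euclid_dist n (est y) \<theta>" if "y \<notin> B \<theta>"
        using that y by (auto simp: B_def)
      then show "ennreal ((\<delta> / 2)\<^sup>2) * indicator (space (law \<theta>) - B \<theta>) y \<le>
          ennreal ((euclid_dist n (est y) \<theta>)\<^sup>2)"
        using \<delta> by (auto simp: indicator_def simp del: power_divide intro!: ennreal_leI power_mono)
    qed
    also have "\<dots> = risk n h T A est \<theta>"
      by (simp add: risk_def law_def)
    also have "\<dots> \<le> (SUP \<theta>0\<in>K. risk n h T A est \<theta>0)"
      using \<theta> by (rule SUP_upper)
    finally show "ennreal (\<epsilon>\<^sup>2 / (8 * c\<^sup>2)) \<le> (SUP \<theta>0\<in>K. risk n h T A est \<theta>0)" .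
  qed
qed simp

end
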